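(* Let $\alpha,\beta\in\mathbb{R}^J$, let $\phi=\phi(v)\in\mathbb{R}^J$ be the basis-function activation vector at a given value $v$ of the scheduling variable, and let $A=\sqrt{(\alpha^{\mathsf T}\phi)^2+(\beta^{\mathsf T}\phi)^2}$. Let $\hat\alpha$ and $\hat\beta$ be the least-squares estimates of $\alpha$ and $\beta$ obtained from $N$ data points generated by the model $$y_i=\alpha^{\mathsf T}\phi(v_i)\cos(x_i)+\beta^{\mathsf T}\phi(v_i)\sin(x_i)+e_i,\qquad e_i\sim\mathcal N(0,\sigma^2)\ \text{independent},\quad i=1,\dots,N,$$ which are unbiased and have covariance matrices tending to $0$ as $N\to\infty$. Then $$\hat A=\sqrt{\left(\hat\alpha^{\mathsf T}\phi\right)^2+\left(\hat\beta^{\mathsf T}\phi\right)^2}$$ is an asymptotically unbiased and consistent estimate of $A$ as $N\to\infty$.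
   Context: Here $\phi(v)=\begin{bmatrix}\kappa_1(v)&\cdots&\kappa_J(v)\end{bmatrix}^{\mathsf T}\in\mathbb{R}^J$ is a known vector of basis-function activations (for example Gaussian radial basis functions), and the sampling locations $x_i$ and scheduling values $v_i$ are known. An estimate is asymptotically unbiased if its expected value converges to the true value as $N\to\infty$; an estimate is consistent if it is asymptotically unbiased and its variance tends to $0$ as the number of data points $N$ grows. *)

theory Defs
  imports "HOL-Probability.Probability"
begin

definition basis_activation :: "('j::finite \<Rightarrow> 's \<Rightarrow> real) \<Rightarrow> 's \<Rightarrow> real ^ 'j"
  where "basis_activation \<kappa> v = (\<chi> j. \<kappa> j v)"

definition model_output ::
    "('j::finite \<Rightarrow> 's \<Rightarrow> real) \<Rightarrow> real ^ 'j \<Rightarrow> real ^ 'j \<Rightarrow> 's \<Rightarrow> real \<Rightarrow> real"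
  where "model_output \<kappa> a b v x =
    (a \<bullet> basis_activation \<kappa> v) * cos x + (b \<bullet> basis_activation \<kappa> v) * sin x"

definition residual_sum_of_squares ::
    "('j::finite \<Rightarrow> 's \<Rightarrow> real) \<Rightarrow> (nat \<Rightarrow> 's) \<Rightarrow> (nat \<Rightarrow> real) \<Rightarrow> (nat \<Rightarrow> real) \<Rightarrow> nat \<Rightarrow>
      real ^ 'j \<Rightarrow> real ^ 'j \<Rightarrow> real"
  where "residual_sum_of_squares \<kappa> v x y N a b =
    (\<Sum>i = 1..N. (y i - model_output \<kappa> a b (v i) (x i))\<^sup>2)"

text \<open>Minimisers need not be unique, for instance when there are fewer data points than
  parameters, so being a least-squares estimate is a predicate.\<close>

definition least_squares_estimate ::
    "('j::finite \<Rightarrow> 's \<Rightarrow> real) \<Rightarrow> (nat \<Rightarrow> 's) \<Rightarrow> (nat \<Rightarrow> real) \<Rightarrow> (nat \<Rightarrow> real) \<Rightarrow> nat \<Rightarrow>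
      real ^ 'j \<Rightarrow> real ^ 'j \<Rightarrow> bool"
  where "least_squares_estimate \<kappa> v x y N a b \<longleftrightarrow>
    (\<forall>a' b'. residual_sum_of_squares \<kappa> v x y N a b \<le> residual_sum_of_squares \<kappa> v x y N a' b')"

text \<open>Bochner integrals of non-integrable functions are \<open>0\<close> by convention, so the existence of
  the moments is part of the definitions below.\<close>

definition unbiased_estimate ::
    "'a measure \<Rightarrow> ('a \<Rightarrow> 'b::{banach, second_countable_topology}) \<Rightarrow> 'b \<Rightarrow> bool"
  where "unbiased_estimate M X \<theta> \<longleftrightarrow> integrable M X \<and> integral\<^sup>L M X = \<theta>"

definition finite_second_moment ::
    "'a measure \<Rightarrow> ('a \<Rightarrow> 'b::{real_normed_vector, second_countable_topology}) \<Rightarrow> bool"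
  where "finite_second_moment M X \<longleftrightarrow>
    X \<in> borel_measurable M \<and> integrable M (\<lambda>\<omega>. (norm (X \<omega>))\<^sup>2)"

definition covariance_matrix :: "'a measure \<Rightarrow> ('a \<Rightarrow> real ^ 'j::finite) \<Rightarrow> real ^ 'j ^ 'j"
  where "covariance_matrix M X =
    (\<chi> i j. \<integral>\<omega>. (X \<omega> $ i - (\<integral>\<omega>'. X \<omega>' $ i \<partial>M)) * (X \<omega> $ j - (\<integral>\<omega>'. X \<omega>' $ j \<partial>M)) \<partial>M)"

definition covariance_vanishes :: "'a measure \<Rightarrow> (nat \<Rightarrow> 'a \<Rightarrow> real ^ 'j::finite) \<Rightarrow> bool"
  where "covariance_vanishes M X \<longleftrightarrow>
    (\<forall>\<^sub>F N in sequentially. finite_second_moment M (X N)) \<and>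
    (\<lambda>N. covariance_matrix M (X N)) \<longlonglongrightarrow> 0"

definition asymptotically_unbiased :: "'a measure \<Rightarrow> (nat \<Rightarrow> 'a \<Rightarrow> real) \<Rightarrow> real \<Rightarrow> bool"
  where "asymptotically_unbiased M X \<theta> \<longleftrightarrow>
    (\<forall>\<^sub>F N in sequentially. integrable M (X N)) \<and> (\<lambda>N. integral\<^sup>L M (X N)) \<longlonglongrightarrow> \<theta>"

text \<open>Consistency in the mean-square sense (vanishing bias and variance), not merely
  convergence in probability.\<close>

definition consistent_estimate :: "'a measure \<Rightarrow> (nat \<Rightarrow> 'a \<Rightarrow> real) \<Rightarrow> real \<Rightarrow> bool"
  where "consistent_estimate M X \<theta> \<longleftrightarrow>
    asymptotically_unbiased M X \<theta> \<and>
    (\<forall>\<^sub>F N in sequentially. finite_second_moment M (X N)) \<and>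
    (\<lambda>N. prob_space.variance M (X N)) \<longlonglongrightarrow> 0"

definition amplitude :: "real ^ 'j::finite \<Rightarrow> real ^ 'j \<Rightarrow> real ^ 'j \<Rightarrow> real"
  where "amplitude p a b = sqrt ((a \<bullet> p)\<^sup>2 + (b \<bullet> p)\<^sup>2)"

end

theory Submission
  imports Defs
begin

text \<open>The amplitude is a norm of a linear function of \<open>(a, b)\<close>, hence Lipschitz, so the mean square
  error of the amplitude estimate is at most \<open>(norm \<phi>)\<^sup>2\<close> times the sum of the mean square errors of the two
  coefficient estimates. For unbiased estimates these are the traces of the covariance matrices. A
  vanishing mean square error makes both bias and variance vanish.\<close>

lemma amplitude_eq_norm: "amplitude p a b = norm (a \<bullet> p, b \<bullet> p)"
  by (simp add: amplitude_def norm_Pair)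

text \<open>The reverse triangle inequality in the plane bounds the difference of two amplitudes by
  the norm of the difference of the points; Cauchy-Schwarz in each coordinate then extracts the
  factor \<open>norm p\<close>.\<close>

lemma amplitude_diff_power2_le:
  "(amplitude p a b - amplitude p a' b')\<^sup>2 \<le> (norm p)\<^sup>2 * ((norm (a - a'))\<^sup>2 + (norm (b - b'))\<^sup>2)"
proof -
  have "\<bar>amplitude p a b - amplitude p a' b'\<bar> \<le> norm ((a - a') \<bullet> p, (b - b') \<bullet> p)"
    using norm_triangle_ineq3[of "(a \<bullet> p, b \<bullet> p)" "(a' \<bullet> p, b' \<bullet> p)"]
    by (simp add: amplitude_eq_norm inner_diff_left)
  \<comment> \<open>\<open>abs_le_square_iff\<close> compares two absolute values, so the right-hand
    norm is first enlarged to its own absolute value.\<close>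
  then have "(amplitude p a b - amplitude p a' b')\<^sup>2 \<le> (norm ((a - a') \<bullet> p, (b - b') \<bullet> p))\<^sup>2"
    by (rule abs_le_square_iff[THEN iffD1, OF order_trans[OF _ abs_ge_self]])
  also have "\<dots> = ((a - a') \<bullet> p)\<^sup>2 + ((b - b') \<bullet> p)\<^sup>2"
    by (simp add: norm_Pair)
  also have "\<dots> \<le> (norm (a - a') * norm p)\<^sup>2 + (norm (b - b') * norm p)\<^sup>2"
    by (intro add_mono) (simp_all add: abs_le_square_iff[symmetric] Cauchy_Schwarz_ineq2)
  finally show ?thesis
    by (simp add: power_mult_distrib algebra_simps)
qed

text \<open>Expanding the square leaves the second moment, a cross term linear in \<open>X\<close>,
  and a constant, which is integrable because the measure is finite.\<close>

lemma (in prob_space) integrable_norm_diff_power2: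
  fixes X :: "'a \<Rightarrow> real ^ 'j::finite"
  assumes "integrable M X" "finite_second_moment M X"
  shows "integrable M (\<lambda>\<omega>. (norm (X \<omega> - c))\<^sup>2)"
proof -
  have "integrable M (\<lambda>\<omega>. (norm (X \<omega>))\<^sup>2 - 2 * (X \<omega> \<bullet> c) + (norm c)\<^sup>2)"
    using assms unfolding finite_second_moment_def by auto
  moreover have "(norm (X \<omega> - c))\<^sup>2 = (norm (X \<omega>))\<^sup>2 - 2 * (X \<omega> \<bullet> c) + (norm c)\<^sup>2" for \<omega>
    unfolding power2_norm_eq_inner
    by (simp only: inner_diff_left inner_diff_right inner_commute[of c "X \<omega>"])
  ultimately show ?thesis
    by simp
qed

text \<open>Since \<open>\<theta>\<close> is the mean, the i-th diagonal covariance entry is the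
  expected squared error of component i; summing over i gives the squared Euclidean norm.\<close>

lemma (in prob_space) mean_square_error_eq_trace:
  fixes X :: "'a \<Rightarrow> real ^ 'j::finite"
  assumes "unbiased_estimate M X \<theta>" "finite_second_moment M X"
  shows "expectation (\<lambda>\<omega>. (norm (X \<omega> - \<theta>))\<^sup>2) = trace (covariance_matrix M X)"
proof -
  have int: "integrable M X" and mean: "integral\<^sup>L M X = \<theta>"
    using assms(1) by (auto simp: unbiased_estimate_def)
  \<comment> \<open>Coordinate projection is bounded linear and therefore commutes with the
    expectation.\<close>
  have comp: "expectation (\<lambda>\<omega>. X \<omega> $ i) = \<theta> $ i" for i
    using integral_bounded_linear[OF bounded_linear_vec_nth int, of i] mean by simp
  \<comment> \<open>Exchanging expectation and finite sum requires each summand to be integrable;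
    each one is dominated by the full squared norm.\<close>
  have "integrable M (\<lambda>\<omega>. (X \<omega> $ i - \<theta> $ i)\<^sup>2)" for i
  proof (rule Bochner_Integration.integrable_bound[OF integrable_norm_diff_power2[OF int assms(2), of \<theta>]])
    have "(\<lambda>\<omega>. X \<omega> $ i) \<in> borel_measurable M"
      using integrable_bounded_linear[OF bounded_linear_vec_nth int] by (rule borel_measurable_integrable)
    then show "(\<lambda>\<omega>. (X \<omega> $ i - \<theta> $ i)\<^sup>2) \<in> borel_measurable M"
      by simp
    show "AE \<omega> in M. norm ((X \<omega> $ i - \<theta> $ i)\<^sup>2) \<le> norm ((norm (X \<omega> - \<theta>))\<^sup>2)"
      using component_le_norm_cart[of "X _ - \<theta>" i]
      by (intro always_eventually allI) (simp add: abs_le_square_iff[symmetric])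
  qed
  then have "expectation (\<lambda>\<omega>. \<Sum>i\<in>UNIV. (X \<omega> $ i - \<theta> $ i)\<^sup>2)
      = (\<Sum>i\<in>UNIV. expectation (\<lambda>\<omega>. (X \<omega> $ i - \<theta> $ i)\<^sup>2))"
    by (intro Bochner_Integration.integral_sum)
  moreover have "(norm (X \<omega> - \<theta>))\<^sup>2 = (\<Sum>i\<in>UNIV. (X \<omega> $ i - \<theta> $ i)\<^sup>2)" for \<omega>
    unfolding power2_norm_eq_inner by (simp add: inner_vec_def power2_eq_square)
  ultimately show ?thesis
    by (simp add: trace_def covariance_matrix_def comp power2_eq_square)
qed

text \<open>The trace is a finite sum of entries that each tend to 0. It agrees with the mean square
  error only from some \<open>N\<close> on, which suffices for the limit.\<close>

lemma (in prob_space) mean_square_error_tendsto_0: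
  fixes X :: "nat \<Rightarrow> 'a \<Rightarrow> real ^ 'j::finite"
  assumes "\<forall>\<^sub>F N in sequentially. unbiased_estimate M (X N) \<theta>" "covariance_vanishes M X"
  shows "(\<lambda>N. expectation (\<lambda>\<omega>. (norm (X N \<omega> - \<theta>))\<^sup>2)) \<longlonglongrightarrow> 0"
proof -
  have "(\<lambda>N. covariance_matrix M (X N) $ i $ i) \<longlonglongrightarrow> 0" for i
    using tendsto_vec_nth[OF tendsto_vec_nth, of "\<lambda>N. covariance_matrix M (X N)" 0 sequentially i i] assms(2)
    by (simp add: covariance_vanishes_def)
  then have "(\<lambda>N. trace (covariance_matrix M (X N))) \<longlonglongrightarrow> 0"
    unfolding trace_def by (rule tendsto_null_sum)
  moreover have "\<forall>\<^sub>F N in sequentially.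
      trace (covariance_matrix M (X N)) = expectation (\<lambda>\<omega>. (norm (X N \<omega> - \<theta>))\<^sup>2)"
    using assms(1) conjunct1[OF assms(2)[unfolded covariance_vanishes_def]]
    by eventually_elim (simp add: mean_square_error_eq_trace)
  ultimately show ?thesis
    by (rule Lim_transform_eventually)
qed

text \<open>Bias-variance decomposition. The two moments of \<open>X\<close> are derived from the
  integrability of the squared error, so that no integral in the identity takes the default value
  0.\<close>

lemma (in prob_space) mean_square_error_decomp:
  fixes X :: "'a \<Rightarrow> real"
  assumes "X \<in> borel_measurable M" "integrable M (\<lambda>\<omega>. (X \<omega> - \<theta>)\<^sup>2)"
  shows "integrable M X" "finite_second_moment M X"
    "expectation (\<lambda>\<omega>. (X \<omega> - \<theta>)\<^sup>2) = variance X + (expectation X - \<theta>)\<^sup>2"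
proof -
  \<comment> \<open>On a probability space, square integrability implies integrability.\<close>
  have int: "integrable M (\<lambda>\<omega>. X \<omega> - \<theta>)"
    by (rule square_integrable_imp_integrable) (use assms in simp_all)
  from Bochner_Integration.integrable_add[OF this integrable_const[of \<theta>]]
  show intX: "integrable M X"
    by simp
  have "integrable M (\<lambda>\<omega>. (X \<omega> - \<theta>)\<^sup>2 + 2 * \<theta> * X \<omega> - \<theta>\<^sup>2)"
    using assms intX by auto
  moreover have "(X \<omega> - \<theta>)\<^sup>2 + 2 * \<theta> * X \<omega> - \<theta>\<^sup>2 = (X \<omega>)\<^sup>2" for \<omega>
    by (simp add: power2_diff)
  ultimately have intX2: "integrable M (\<lambda>\<omega>. (X \<omega>)\<^sup>2)"
    by simp
  then show "finite_second_moment M X"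
    using assms by (simp add: finite_second_moment_def)
  have "(X \<omega> - \<theta>)\<^sup>2 = (X \<omega>)\<^sup>2 - 2 * \<theta> * X \<omega> + \<theta>\<^sup>2" for \<omega>
    by (simp add: power2_diff)
  then have "expectation (\<lambda>\<omega>. (X \<omega> - \<theta>)\<^sup>2) = expectation (\<lambda>\<omega>. (X \<omega>)\<^sup>2 - 2 * \<theta> * X \<omega> + \<theta>\<^sup>2)"
    by simp
  also have "\<dots> = expectation (\<lambda>\<omega>. (X \<omega>)\<^sup>2) - 2 * \<theta> * expectation X + \<theta>\<^sup>2"
    using intX intX2 by (simp add: prob_space)
  finally show "expectation (\<lambda>\<omega>. (X \<omega> - \<theta>)\<^sup>2) = variance X + (expectation X - \<theta>)\<^sup>2"
    using variance_eq[OF intX intX2] power2_diff[of "expectation X" \<theta>] by simp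
qed

text \<open>Variance and squared bias are nonnegative and add up to the mean square error, so each
  is squeezed between 0 and a null sequence.\<close>

lemma (in prob_space) consistent_estimate_if_mean_square_error_tendsto_0:
  assumes "\<forall>\<^sub>F N in sequentially. X N \<in> borel_measurable M \<and> integrable M (\<lambda>\<omega>. (X N \<omega> - \<theta>)\<^sup>2)"
    and lim: "(\<lambda>N. expectation (\<lambda>\<omega>. (X N \<omega> - \<theta>)\<^sup>2)) \<longlonglongrightarrow> 0"
  shows "consistent_estimate M X \<theta>"
proof -
  have ev: "\<forall>\<^sub>F N in sequentially. integrable M (X N) \<and> finite_second_moment M (X N) \<and>
      expectation (\<lambda>\<omega>. (X N \<omega> - \<theta>)\<^sup>2) = variance (X N) + (expectation (X N) - \<theta>)\<^sup>2"
    using assms(1) by eventually_elim (blast intro: mean_square_error_decomp)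
  have "(\<lambda>N. variance (X N)) \<longlonglongrightarrow> 0"
    by (rule tendsto_sandwich[OF _ _ tendsto_const lim])
      (use ev in \<open>auto elim!: eventually_mono intro: variance_positive\<close>)
  moreover have "(\<lambda>N. (expectation (X N) - \<theta>)\<^sup>2) \<longlonglongrightarrow> 0"
    by (rule tendsto_sandwich[OF _ _ tendsto_const lim])
      (use ev in \<open>auto elim!: eventually_mono intro: variance_positive\<close>)
  then have "(\<lambda>N. expectation (X N)) \<longlonglongrightarrow> \<theta>"
    by (simp add: LIM_zero_iff)
  ultimately show ?thesis
    using ev by (auto simp: consistent_estimate_def asymptotically_unbiased_def elim: eventually_mono)
qed

text \<open>The Lipschitz bound separates into an error of \<open>X\<close> and an error of
  \<open>Y\<close>, so the argument works for any joint law of the two estimates.\<close>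

lemma (in prob_space) amplitude_consistent:
  fixes X Y :: "nat \<Rightarrow> 'a \<Rightarrow> real ^ 'j::finite"
  assumes X: "\<forall>\<^sub>F N in sequentially. unbiased_estimate M (X N) a" "covariance_vanishes M X"
    and Y: "\<forall>\<^sub>F N in sequentially. unbiased_estimate M (Y N) b" "covariance_vanishes M Y"
  shows "consistent_estimate M (\<lambda>N \<omega>. amplitude p (X N \<omega>) (Y N \<omega>)) (amplitude p a b)"
proof (rule consistent_estimate_if_mean_square_error_tendsto_0)
  let ?A = "\<lambda>N \<omega>. amplitude p (X N \<omega>) (Y N \<omega>)"
  let ?SE = "\<lambda>N \<omega>. (?A N \<omega> - amplitude p a b)\<^sup>2"
  let ?mse = "\<lambda>N. (norm p)\<^sup>2 *
    (expectation (\<lambda>\<omega>. (norm (X N \<omega> - a))\<^sup>2) + expectation (\<lambda>\<omega>. (norm (Y N \<omega> - b))\<^sup>2))"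
  have step: "?A N \<in> borel_measurable M \<and> integrable M (?SE N) \<and> expectation (?SE N) \<le> ?mse N"
    if "unbiased_estimate M (X N) a" "finite_second_moment M (X N)"
      "unbiased_estimate M (Y N) b" "finite_second_moment M (Y N)" for N
  proof -
    have int: "integrable M (\<lambda>\<omega>. (norm (X N \<omega> - a))\<^sup>2)" "integrable M (\<lambda>\<omega>. (norm (Y N \<omega> - b))\<^sup>2)"
      using that by (auto intro!: integrable_norm_diff_power2 simp: unbiased_estimate_def)
    have [measurable]: "X N \<in> borel_measurable M" "Y N \<in> borel_measurable M"
      using that by (auto simp: finite_second_moment_def)
    have meas [measurable]: "?A N \<in> borel_measurable M"
      unfolding amplitude_def by measurable
    have bound: "integrable M (\<lambda>\<omega>. (norm p)\<^sup>2 * ((norm (X N \<omega> - a))\<^sup>2 + (norm (Y N \<omega> - b))\<^sup>2))"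
      using int by auto
    \<comment> \<open>Integrability comes before the comparison of expectations, because
      monotonicity of the Bochner integral needs both sides integrable.\<close>
    have SE: "integrable M (?SE N)"
    proof (rule Bochner_Integration.integrable_bound[OF bound])
      show "AE \<omega> in M. norm (?SE N \<omega>)
          \<le> norm ((norm p)\<^sup>2 * ((norm (X N \<omega> - a))\<^sup>2 + (norm (Y N \<omega> - b))\<^sup>2))"
        by (intro always_eventually allI) (use amplitude_diff_power2_le in simp)
    qed measurable
    have "expectation (?SE N)
        \<le> expectation (\<lambda>\<omega>. (norm p)\<^sup>2 * ((norm (X N \<omega> - a))\<^sup>2 + (norm (Y N \<omega> - b))\<^sup>2))"
      by (rule integral_mono[OF SE bound amplitude_diff_power2_le])
    also have "\<dots> = ?mse N"
      using int by simp
    finally show ?thesis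
      using meas SE by blast
  qed
  \<comment> \<open>Unbiasedness and finite second moments are each available only for large
    \<open>N\<close>; the four eventual statements are intersected before \<open>step\<close>
    applies.\<close>
  have ev: "\<forall>\<^sub>F N in sequentially.
      ?A N \<in> borel_measurable M \<and> integrable M (?SE N) \<and> expectation (?SE N) \<le> ?mse N"
    using X(1) conjunct1[OF X(2)[unfolded covariance_vanishes_def]]
      Y(1) conjunct1[OF Y(2)[unfolded covariance_vanishes_def]]
    by eventually_elim (rule step)
  then show "\<forall>\<^sub>F N in sequentially. ?A N \<in> borel_measurable M \<and> integrable M (?SE N)"
    by (auto elim: eventually_mono)
  have lim: "?mse \<longlonglongrightarrow> 0"
    by (intro tendsto_mult_right_zero tendsto_add_zero mean_square_error_tendsto_0 X Y)
  show "(\<lambda>N. expectation (?SE N)) \<longlonglongrightarrow> 0"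
    by (rule tendsto_sandwich[OF _ _ tendsto_const lim])
      (use ev in \<open>auto elim!: eventually_mono\<close>)
qed

theorem corollary2:
  fixes M :: "'a measure"
    and \<kappa> :: "'j::finite \<Rightarrow> 's \<Rightarrow> real"
    and \<alpha> \<beta> :: "real ^ 'j"
    and v\<^sub>0 :: 's
    and v :: "nat \<Rightarrow> 's"
    and x :: "nat \<Rightarrow> real"
    and e y :: "nat \<Rightarrow> 'a \<Rightarrow> real"
    and \<sigma> :: real
    and \<alpha>_hat \<beta>_hat :: "nat \<Rightarrow> 'a \<Rightarrow> real ^ 'j"
  defines "\<phi> \<equiv> basis_activation \<kappa> v\<^sub>0"
  assumes "prob_space M"
    and "\<sigma> > 0"
    and "prob_space.indep_vars M (\<lambda>_. borel) e {1..}"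
    and "\<And>i. i \<ge> 1 \<Longrightarrow> distributed M lborel (e i) (normal_density 0 \<sigma>)"
    and "\<And>i \<omega>. i \<ge> 1 \<Longrightarrow> \<omega> \<in> space M \<Longrightarrow> y i \<omega> = model_output \<kappa> \<alpha> \<beta> (v i) (x i) + e i \<omega>"
    and "\<And>N \<omega>. N \<ge> 1 \<Longrightarrow> \<omega> \<in> space M \<Longrightarrow>
           least_squares_estimate \<kappa> v x (\<lambda>i. y i \<omega>) N (\<alpha>_hat N \<omega>) (\<beta>_hat N \<omega>)"
    and "\<forall>\<^sub>F N in sequentially. unbiased_estimate M (\<alpha>_hat N) \<alpha>"
    and "\<forall>\<^sub>F N in sequentially. unbiased_estimate M (\<beta>_hat N) \<beta>"
    and "covariance_vanishes M \<alpha>_hat"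
    and "covariance_vanishes M \<beta>_hat"
  shows "asymptotically_unbiased M (\<lambda>N \<omega>. amplitude \<phi> (\<alpha>_hat N \<omega>) (\<beta>_hat N \<omega>)) (amplitude \<phi> \<alpha> \<beta>)
       \<and> consistent_estimate M (\<lambda>N \<omega>. amplitude \<phi> (\<alpha>_hat N \<omega>) (\<beta>_hat N \<omega>)) (amplitude \<phi> \<alpha> \<beta>)"
proof -
  interpret prob_space M by fact
  have "consistent_estimate M (\<lambda>N \<omega>. amplitude \<phi> (\<alpha>_hat N \<omega>) (\<beta>_hat N \<omega>)) (amplitude \<phi> \<alpha> \<beta>)"
    by (rule amplitude_consistent) fact+
  \<comment> \<open>Asymptotic unbiasedness is a conjunct of \<open>consistent_estimate\<close>, so
    both claims follow at once.\<close>
  then show ?thesis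
    by (simp add: consistent_estimate_def)
qed

end
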